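(* Let $A_N$ be the adjacency matrix of the $N$-fold comb product of $(\mathbf K_2,o)$ with itself, where $\mathbf K_2$ is the complete graph on two vertices with one vertex $o$ chosen as root. Then the empirical eigenvalue distribution of $A_N$ converges weakly to $\lambda$ as $N\to\infty$, where $\lambda$ is the symmetric probability measure defined in the context.
   Context: The comb product of rooted graphs $(\mathbf\Gamma_1,o_1)=(V_1,E_1,o_1)$ and $(\mathbf\Gamma_2,o_2)=(V_2,E_2,o_2)$ is the rooted graph with vertex set $V_1\times V_2$ and root $(o_1,o_2)$, in which $(x_1,x_2)$ and $(y_1,y_2)$ are adjacent iff either $x_1y_1\in E_1$ and $x_2=y_2=o_2$, or $x_1=y_1$ and $x_2y_2\in E_2$. This product is associative, so $N$-fold products are well defined. The empirical eigenvalue distribution of a self-adjoint $m\times m$ matrix with eigenvalues $\lambda_1,\dots,\lambda_m$ (with multiplicity) is $\frac1m\sum_{i=1}^m\delta_{\lambda_i}$. Let $L_+\colon[0,\infty)\to[0,1)$ be the distribution function, due to Smyth, characterized by the properties that $L_+$ is strictly increasing, $L_+(0)=0$, and $$|2L_+(x)-1|=L_+\bigl(|x-x^{-1}|\bigr),\qquad x>0.$$ ($L_+$ is known to be continuous.) Let $\lambda_+$ be the probability measure on $[0,\infty)$ with distribution function $L_+$, and let $\lambda$ be its symmetrization, i.e. $\lambda(B)=\frac12(\lambda_+(B\cap[0,\infty))+\lambda_+((-B)\cap[0,\infty)))$ for Borel $B\subseteq\mathbb R$. *)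

theory Defs
  imports "HOL-Probability.Weak_Convergence" "HOL-Probability.Probability_Mass_Function"
    "Jordan_Normal_Form.Char_Poly"
begin

section \<open>Rooted graphs and the comb product\<close>

(* Simple undirected graphs: an edge is a two-element set of vertices. *)
record 'a rooted_graph =
  rg_verts :: "'a set"
  rg_edges :: "'a set set"
  rg_root :: 'a

definition complete_rooted_graph :: "'a set \<Rightarrow> 'a \<Rightarrow> 'a rooted_graph" where
  "complete_rooted_graph V r =
     \<lparr>rg_verts = V, rg_edges = {{x, y} | x y. x \<in> V \<and> y \<in> V \<and> x \<noteq> y}, rg_root = r\<rparr>"

definition comb_product :: "'a rooted_graph \<Rightarrow> 'b rooted_graph \<Rightarrow> ('a \<times> 'b) rooted_graph" where
  "comb_product G H =
     \<lparr>rg_verts = rg_verts G \<times> rg_verts H,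
      rg_edges = {{(x1, x2), (y1, y2)} | x1 x2 y1 y2.
         (x1, x2) \<in> rg_verts G \<times> rg_verts H \<and> (y1, y2) \<in> rg_verts G \<times> rg_verts H \<and>
         ({x1, y1} \<in> rg_edges G \<and> x2 = rg_root H \<and> y2 = rg_root H \<or>
          x1 = y1 \<and> {x2, y2} \<in> rg_edges H)},
      rg_root = (rg_root G, rg_root H)\<rparr>"

definition relabel :: "('a \<Rightarrow> 'b) \<Rightarrow> 'a rooted_graph \<Rightarrow> 'b rooted_graph" where
  "relabel f G =
     \<lparr>rg_verts = f ` rg_verts G, rg_edges = (\<lambda>e. f ` e) ` rg_edges G, rg_root = f (rg_root G)\<rparr>"

(* The N-fold product has N-tuples as vertices; to have one type for all N, tuples are lists
   of length N, and the pairs of each binary product are relabelled along the injection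
   (x, xs) |-> x # xs.  The 0-fold product is the one-vertex graph, a unit for the comb
   product up to isomorphism. *)
primrec comb_power :: "'a rooted_graph \<Rightarrow> nat \<Rightarrow> 'a list rooted_graph" where
  "comb_power G 0 = \<lparr>rg_verts = {[]}, rg_edges = {}, rg_root = []\<rparr>"
| "comb_power G (Suc n) = relabel (\<lambda>(x, xs). x # xs) (comb_product G (comb_power G n))"

section \<open>Adjacency matrices and empirical eigenvalue distributions\<close>

(* The vertices are ordered by a list vs that is meant to enumerate them without repetition. *)
definition adjacency_matrix :: "'a list \<Rightarrow> 'a rooted_graph \<Rightarrow> real mat" where
  "adjacency_matrix vs G =
     mat (length vs) (length vs) (\<lambda>(i, j). if {vs ! i, vs ! j} \<in> rg_edges G then 1 else 0)"

(* Meant for symmetric real matrices A of positive dimension m.  The characteristic polynomial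
   of such an A splits over the reals, so the multiset of its roots consists of the m
   eigenvalues of A with multiplicity, and pmf_of_multiset puts mass 1/m on each of them. *)
definition empirical_eigenvalue_distribution :: "real mat \<Rightarrow> real measure" where
  "empirical_eigenvalue_distribution A =
     distr (measure_pmf (pmf_of_multiset (proots (char_poly A)))) borel (\<lambda>x. x)"

section \<open>The limit distribution\<close>

(* L is a function on [0, oo); its values on the negative half-line are irrelevant. *)
definition smyth_function :: "(real \<Rightarrow> real) \<Rightarrow> bool" where
  "smyth_function L \<longleftrightarrow>
     (\<forall>x\<ge>0. 0 \<le> L x \<and> L x < 1) \<and>
     strict_mono_on {0..} L \<and>
     L 0 = 0 \<and>
     (\<forall>x>0. \<bar>2 * L x - 1\<bar> = L \<bar>x - inverse x\<bar>)"

(* interval_measure requires a right-continuous function; for a function L as in smyth_function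
   continuity on [0, oo) and the limit 1 at infinity follow from the defining properties (all
   dyadic rationals in [0, 1) are values of L), so the measure has distribution function L. *)
definition half_line_measure :: "(real \<Rightarrow> real) \<Rightarrow> real measure" where
  "half_line_measure L = interval_measure (\<lambda>x. if x < 0 then 0 else L x)"

definition symmetrization :: "real measure \<Rightarrow> real measure" where
  "symmetrization M = measure_of UNIV (sets borel)
     (\<lambda>B. (emeasure M (B \<inter> {0..}) + emeasure M (uminus ` B \<inter> {0..})) / 2)"

lemma emeasure_symmetrization:
  assumes M: "sets M = sets borel" and B: "B \<in> sets borel"
  shows "emeasure (symmetrization M) B =
    (emeasure M (B \<inter> {0..}) + emeasure M (uminus ` B \<inter> {0..})) / 2"
proof -
  have meas: "uminus ` C \<in> sets borel" if "C \<in> sets borel" for C :: "real set"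
  proof -
    have "uminus ` C = uminus -` C \<inter> space borel"
      by (auto simp: image_iff) (metis minus_minus)
    then show ?thesis
      using measurable_sets[OF _ that, of "uminus :: real \<Rightarrow> real" borel] by simp
  qed
  show ?thesis
    unfolding symmetrization_def
  proof (rule emeasure_measure_of_sigma[OF _ _ _ B])
    show "sigma_algebra (UNIV :: real set) (sets borel)"
      using sets.sigma_algebra_axioms[of "borel :: real measure"] by simp
    show "positive (sets borel)
      (\<lambda>B. (emeasure M (B \<inter> {0..}) + emeasure M (uminus ` B \<inter> {0..})) / 2)"
      by (simp add: positive_def)
    show "countably_additive (sets borel)
      (\<lambda>B. (emeasure M (B \<inter> {0..}) + emeasure M (uminus ` B \<inter> {0..})) / 2)"
    proof (rule countably_additiveI)
      fix A :: "nat \<Rightarrow> real set"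
      assume A: "range A \<subseteq> sets borel" "disjoint_family A"
      have A': "A i \<in> sets borel" for i using A(1) by auto
      have 1: "(\<Sum>i. emeasure M (A i \<inter> {0..})) = emeasure M ((\<Union>i. A i) \<inter> {0..})"
        using A A' by (subst suminf_emeasure) (auto simp: M disjoint_family_on_def)
      have 2: "(\<Sum>i. emeasure M (uminus ` A i \<inter> {0..})) =
          emeasure M (uminus ` (\<Union>i. A i) \<inter> {0..})"
      proof (subst suminf_emeasure)
        show "range (\<lambda>i. uminus ` A i \<inter> {0..}) \<subseteq> sets M"
          using meas[OF A'] by (auto simp: M)
        show "disjoint_family (\<lambda>i. uminus ` A i \<inter> {0..})"
          using A(2) unfolding disjoint_family_on_def by fastforce
        show "emeasure M (\<Union>i. uminus ` A i \<inter> {0..}) =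
            emeasure M (uminus ` (\<Union>i. A i) \<inter> {0..})"
          by (rule arg_cong[of _ _ "emeasure M"]) auto
      qed
      show "(\<Sum>i. (emeasure M (A i \<inter> {0..}) + emeasure M (uminus ` A i \<inter> {0..})) / 2) =
        (emeasure M (\<Union> (range A) \<inter> {0..}) + emeasure M (uminus ` \<Union> (range A) \<inter> {0..})) / 2"
        unfolding divide_ennreal_def
        by (subst ennreal_suminf_multc, subst suminf_add[symmetric])
           (auto simp: 1 2)
    qed
  qed
qed

end

theory Submission
  imports Defs
begin

text \<open>
  Everything is governed by Boole's transformation \<open>T x = x - 1 / x\<close>, which maps each of the two
  open half-lines increasingly onto the real line.

  On the graph side, fix a number \<open>t\<close> and look for a vector \<open>u\<close> on the \<open>n\<close>-th comb power with value
  \<open>1\<close> at the root for which \<open>(t - A) u\<close> is supported at the root. The next power consists of two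
  copies of the present one whose roots are joined by an edge, so a suitable multiple of \<open>u\<close> on the
  second copy extends \<open>u\<close>, and the value of \<open>(t - A) u\<close> at the root changes from \<open>f\<close> to \<open>T f\<close>. As it
  is \<open>t\<close> for the one-vertex graph, it is \<open>T\<^sup>n t\<close> for the \<open>n\<close>-th power
  (\<open>adjacency_root_response\<close>), and every \<open>t\<close> whose \<open>T\<close>-orbit reaches \<open>0\<close> for the first time at
  step \<open>n\<close> is an eigenvalue. There are \<open>2\<^sup>n\<close> such \<open>t\<close>, as many as there are vertices, so these are
  all the eigenvalues and each of them is simple
  (\<open>empirical_eigenvalue_distribution_comb_power\<close>).

  On the analytic side, the two increasing branches of \<open>T\<close> turn the recursion for this set of zeros
  into a recursion for its distribution function: the values at level \<open>n + 1\<close> are \<open>F\<^sub>n (T x) / 2\<close> for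
  \<open>x < 0\<close> and \<open>(1 + F\<^sub>n (T x)) / 2\<close> for \<open>x > 0\<close> (\<open>zeros_cdf_Suc\<close>). Smyth's functional equation says
  exactly that the symmetrized distribution function is a fixed point of this recursion
  (\<open>symmetric_cdf_boole\<close>). The recursion halves distances, hence the distribution functions are
  within \<open>2\<^sup>-\<^sup>n\<close> of their limit, uniformly on the line (\<open>zeros_cdf_near_symmetric_cdf\<close>).

  The uniform estimate also yields the regularity of Smyth's function: right-continuity and the
  limit at infinity pass to uniform limits, and symmetry turns right-continuity into continuity.
  This identifies the measure that is constructed from the function.
\<close>

section \<open>The adjacency operator of a comb power\<close>

definition adjacency_sum :: "'a rooted_graph \<Rightarrow> ('a \<Rightarrow> real) \<Rightarrow> 'a \<Rightarrow> real" where
  "adjacency_sum G u x = (\<Sum>y | y \<in> rg_verts G \<and> {x, y} \<in> rg_edges G. u y)"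

lemma rg_root_comb_power [simp]: "rg_root (comb_power G n) = replicate n (rg_root G)"
  by (induction n) (auto simp: relabel_def comb_product_def)

lemma rg_verts_comb_power_Suc:
  "rg_verts (comb_power G (Suc n)) = (\<lambda>(x, xs). x # xs) ` (rg_verts G \<times> rg_verts (comb_power G n))"
  by (simp add: relabel_def comb_product_def)

lemma finite_verts_comb_power:
  assumes "finite (rg_verts G)"
  shows "finite (rg_verts (comb_power G n))"
proof (induction n)
  case (Suc n)
  then show ?case using assms by (subst rg_verts_comb_power_Suc) auto
qed simp

lemma card_verts_comb_power:
  assumes "finite (rg_verts G)"
  shows "card (rg_verts (comb_power G n)) = card (rg_verts G) ^ n"
proof (induction n)
  case (Suc n)
  then show ?case
    by (subst rg_verts_comb_power_Suc, subst card_image)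
       (auto simp: inj_on_def card_cartesian_product)
qed simp

lemma length_verts_comb_power: "xs \<in> rg_verts (comb_power G n) \<Longrightarrow> length xs = n"
proof (induction n arbitrary: xs)
  case (Suc n)
  then show ?case by (subst (asm) rg_verts_comb_power_Suc) auto
qed simp

lemma root_in_verts_comb_power:
  "rg_root G \<in> rg_verts G \<Longrightarrow> replicate n (rg_root G) \<in> rg_verts (comb_power G n)"
proof (induction n)
  case (Suc n)
  then show ?case by (subst rg_verts_comb_power_Suc) force
qed simp

lemma comb_power_edge_iff:
  assumes "x \<in> rg_verts G" "y \<in> rg_verts G"
    and "xs \<in> rg_verts (comb_power G n)" "ys \<in> rg_verts (comb_power G n)"
  shows "{x # xs, y # ys} \<in> rg_edges (comb_power G (Suc n)) \<longleftrightarrow>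
    {x, y} \<in> rg_edges G \<and> xs = replicate n (rg_root G) \<and> ys = replicate n (rg_root G) \<or>
    x = y \<and> {xs, ys} \<in> rg_edges (comb_power G n)"
proof -
  let ?f = "\<lambda>(x, xs). x # xs"
  have inj: "inj ?f" by (auto simp: inj_on_def)
  have "{x # xs, y # ys} = ?f ` {(x, xs), (y, ys)}" by simp
  then have "{x # xs, y # ys} \<in> rg_edges (comb_power G (Suc n)) \<longleftrightarrow>
      {(x, xs), (y, ys)} \<in> rg_edges (comb_product G (comb_power G n))"
    by (simp add: relabel_def image_iff inj_image_eq_iff[OF inj] del: image_insert image_empty)
  also have "\<dots> \<longleftrightarrow> {x, y} \<in> rg_edges G \<and> xs = replicate n (rg_root G) \<and> ys = replicate n (rg_root G) \<or>
    x = y \<and> {xs, ys} \<in> rg_edges (comb_power G n)"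
    using assms by (auto simp: comb_product_def doubleton_eq_iff insert_commute)
  finally show ?thesis .
qed

text \<open>The next power consists of disjoint copies of the present one, one for each vertex of the
  factor, and their roots are joined like the vertices of the factor. If the factor has no loops,
  the two kinds of neighbours of a vertex are disjoint, so the sum over the neighbours splits.\<close>

lemma adjacency_sum_comb_power_Suc:
  assumes "finite (rg_verts G)" and root: "rg_root G \<in> rg_verts G"
    and loopless: "\<And>x. {x} \<notin> rg_edges G"
    and x: "x \<in> rg_verts G" and xs: "xs \<in> rg_verts (comb_power G n)"
  shows "adjacency_sum (comb_power G (Suc n)) u (x # xs) =
    adjacency_sum (comb_power G n) (\<lambda>ys. u (x # ys)) xs +
    (if xs = replicate n (rg_root G)
     then adjacency_sum G (\<lambda>y. u (y # replicate n (rg_root G))) x else 0)"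
proof -
  let ?o = "replicate n (rg_root G)"
  let ?A = "(#) x ` {ys \<in> rg_verts (comb_power G n). {xs, ys} \<in> rg_edges (comb_power G n)}"
  let ?B = "if xs = ?o then (\<lambda>y. y # ?o) ` {y \<in> rg_verts G. {x, y} \<in> rg_edges G} else {}"
  have nb: "{z. z \<in> rg_verts (comb_power G (Suc n)) \<and> {x # xs, z} \<in> rg_edges (comb_power G (Suc n))}
      = ?A \<union> ?B" (is "?N = _")
  proof (intro equalityI subsetI)
    fix z assume z: "z \<in> ?N"
    then obtain y ys where "z = y # ys" "y \<in> rg_verts G" "ys \<in> rg_verts (comb_power G n)"
      by (subst (asm) rg_verts_comb_power_Suc) auto
    with z show "z \<in> ?A \<union> ?B"
      using comb_power_edge_iff[OF x _ xs, of y ys] by auto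
  next
    fix z assume z: "z \<in> ?A \<union> ?B"
    then obtain y ys where "z = y # ys" "y \<in> rg_verts G" "ys \<in> rg_verts (comb_power G n)"
      using x root_in_verts_comb_power[OF root] by (auto split: if_splits)
    with z show "z \<in> ?N"
      using comb_power_edge_iff[OF x _ xs, of y ys]
      by (subst rg_verts_comb_power_Suc) (auto split: if_splits)
  qed
  have "?A \<inter> ?B = {}" using loopless by (auto split: if_splits)
  then show ?thesis
    unfolding adjacency_sum_def nb using assms(1)
    by (subst sum.union_disjoint)
       (auto simp: finite_verts_comb_power sum.reindex inj_on_def)
qed

lemma adjacency_sum_complete_graph:
  "x \<in> V \<Longrightarrow> adjacency_sum (complete_rooted_graph V r) u x = sum u (V - {x})"
  unfolding adjacency_sum_def complete_rooted_graph_def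
  by (rule sum.cong) (auto simp: doubleton_eq_iff)

lemma complete_rooted_graph_simps [simp]:
  "rg_verts (complete_rooted_graph V r) = V"
  "rg_root (complete_rooted_graph V r) = r"
  "{x} \<notin> rg_edges (complete_rooted_graph V r)"
  by (auto simp: complete_rooted_graph_def)

section \<open>Eigenvectors and Boole's transformation\<close>

definition boole :: "real \<Rightarrow> real" where
  "boole x = x - inverse x"

text \<open>Excluding \<open>0\<close> at every step keeps the reciprocal away from its default value \<open>1 / 0 = 0\<close>, with
  which \<open>0\<close> would be a fixed point of \<open>boole\<close>.\<close>

primrec boole_zeros :: "nat \<Rightarrow> real set" where
  "boole_zeros 0 = {0}"
| "boole_zeros (Suc n) = {x. x \<noteq> 0 \<and> boole x \<in> boole_zeros n}"

lemma boole_zeros_iff: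
  "x \<in> boole_zeros n \<longleftrightarrow> (boole ^^ n) x = 0 \<and> (\<forall>k<n. (boole ^^ k) x \<noteq> 0)"
proof (induction n arbitrary: x)
  case (Suc n)
  have "(boole ^^ k) (boole x) = (boole ^^ Suc k) x" for k
    by (simp add: funpow_swap1)
  then show ?case
    using Suc by (auto simp: All_less_Suc2 simp del: funpow.simps(2))
qed simp

text \<open>Up to the factor \<open>T\<^sup>n t\<close>, this is the column of the resolvent \<open>(t - A)\<^sup>-\<^sup>1\<close> that belongs to the
  root, normalized to the value \<open>1\<close> at the root. A coordinate away from the root that is followed
  by \<open>k\<close> further coordinates contributes the factor \<open>1 / T\<^sup>k t\<close>.\<close>

primrec root_response :: "'a \<Rightarrow> real \<Rightarrow> 'a list \<Rightarrow> real" where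
  "root_response r t [] = 1"
| "root_response r t (x # xs) =
     (if x = r then 1 else inverse ((boole ^^ length xs) t)) * root_response r t xs"

lemma root_response_root [simp]: "root_response r t (replicate n r) = 1"
  by (induction n) auto

text \<open>In the induction step the two copies carry the multiples \<open>1\<close> and \<open>1 / f\<close> of the vector for the
  present power, where \<open>f = T\<^sup>n t\<close>. Applying \<open>t - A\<close> gives \<open>f\<close> and \<open>1\<close> at the two roots before they
  are joined. The new edge subtracts from each the value at the other root, which leaves
  \<open>f - 1 / f = T f\<close> at the new root and \<open>1 - 1 = 0\<close> at the other one.\<close>

lemma adjacency_root_response:
  fixes V :: "'a set"
  assumes "card V = 2" and r: "r \<in> V" and xs: "xs \<in> rg_verts (comb_power (complete_rooted_graph V r) n)"
    and "\<forall>k<n. (boole ^^ k) t \<noteq> 0"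
  shows "adjacency_sum (comb_power (complete_rooted_graph V r) n) (root_response r t) xs =
    t * root_response r t xs - (if xs = replicate n r then (boole ^^ n) t else 0)"
  using xs assms(4)
proof (induction n arbitrary: xs)
  case 0
  then show ?case by (simp add: adjacency_sum_def)
next
  case (Suc n)
  \<comment> \<open>\<open>c\<close> holds the multiples on the two copies and \<open>\<delta>\<close> indicates the roots of the copies.\<close>
  define c where "c x = (if x = r then 1 else inverse ((boole ^^ n) t))" for x
  let ?K = "complete_rooted_graph V r" and ?\<delta> = "if tl xs = replicate n r then 1 else (0 :: real)"
  have nz: "(boole ^^ n) t \<noteq> 0" using Suc.prems by auto
  obtain s where V: "V = {r, s}" "s \<noteq> r"
    using \<open>card V = 2\<close> r by (auto simp: card_2_iff)
  obtain x ys where xs: "xs = x # ys" and x: "x \<in> V" and ys: "ys \<in> rg_verts (comb_power ?K n)"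
    using Suc.prems(1) by (subst (asm) rg_verts_comb_power_Suc) auto
  have "adjacency_sum (comb_power ?K (Suc n)) (root_response r t) xs =
      adjacency_sum (comb_power ?K n) (\<lambda>zs. c x * root_response r t zs) ys + ?\<delta> * sum c (V - {x})"
  proof -
    have "root_response r t (z # zs) = c z * root_response r t zs"
      if "zs \<in> rg_verts (comb_power ?K n)" for z zs
      using length_verts_comb_power[OF that] by (simp add: c_def)
    moreover have "replicate n r \<in> rg_verts (comb_power ?K n)"
      using root_in_verts_comb_power[of ?K n] r by simp
    moreover have "finite V" using V by simp
    ultimately show ?thesis
      unfolding xs
      by (subst adjacency_sum_comb_power_Suc)
         (simp_all add: x r ys adjacency_sum_complete_graph adjacency_sum_def[of "comb_power ?K n"]
           del: root_response.simps)
  qed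
  also have "adjacency_sum (comb_power ?K n) (\<lambda>zs. c x * root_response r t zs) ys =
      c x * adjacency_sum (comb_power ?K n) (root_response r t) ys"
    by (simp add: adjacency_sum_def sum_distrib_left)
  also have "\<dots> = c x * (t * root_response r t ys - ?\<delta> * (boole ^^ n) t)"
    using Suc.IH[OF ys] Suc.prems(2) by (simp add: xs)
  also have "\<dots> + ?\<delta> * sum c (V - {x}) =
      t * root_response r t xs - ?\<delta> * (c x * (boole ^^ n) t - sum c (V - {x}))"
    using length_verts_comb_power[OF ys] by (simp add: xs c_def algebra_simps)
  also have "c x * (boole ^^ n) t - sum c (V - {x}) = (if x = r then (boole ^^ Suc n) t else 0)"
    using V x nz by (auto simp: c_def boole_def insert_Diff_if)
  also have "?\<delta> * \<dots> = (if xs = replicate (Suc n) r then (boole ^^ Suc n) t else 0)"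
    by (auto simp: xs)
  finally show ?case .
qed

lemma eigenvector_of_adjacency_sum:
  assumes "distinct vs" "set vs = rg_verts G"
    and eigen: "\<And>x. x \<in> rg_verts G \<Longrightarrow> adjacency_sum G u x = t * u x"
    and "z \<in> rg_verts G" "u z \<noteq> 0"
  shows "eigenvector (adjacency_matrix vs G) (vec (length vs) (\<lambda>i. u (vs ! i))) t"
  unfolding eigenvector_def
proof (intro conjI)
  let ?v = "vec (length vs) (\<lambda>i. u (vs ! i))"
  show "?v \<in> carrier_vec (dim_row (adjacency_matrix vs G))"
    by (simp add: adjacency_matrix_def)
  obtain i where "i < length vs" "vs ! i = z"
    using assms by (metis in_set_conv_nth)
  then have "?v $ i \<noteq> 0" using assms by simp
  then show "?v \<noteq> 0\<^sub>v (dim_row (adjacency_matrix vs G))"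
    using \<open>i < length vs\<close> by (metis adjacency_matrix_def dim_row_mat(1) index_zero_vec(1))
  show "adjacency_matrix vs G *\<^sub>v ?v = t \<cdot>\<^sub>v ?v"
  proof (intro eq_vecI)
    fix i assume "i < dim_vec (t \<cdot>\<^sub>v ?v)"
    then have i: "i < length vs" by simp
    let ?g = "\<lambda>y. if {vs ! i, y} \<in> rg_edges G then u y else 0"
    have "(adjacency_matrix vs G *\<^sub>v ?v) $ i = (\<Sum>j<length vs. ?g (vs ! j))"
      using i unfolding adjacency_matrix_def
      by (auto simp: scalar_prod_def atLeast0LessThan intro!: sum.cong)
    also have "\<dots> = sum ?g (set vs)"
      using sum.reindex_bij_betw[OF bij_betw_nth[OF \<open>distinct vs\<close> refl refl], of ?g] by simp
    also have "\<dots> = adjacency_sum G u (vs ! i)"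
      unfolding adjacency_sum_def \<open>set vs = rg_verts G\<close>[symmetric]
      by (simp add: sum.inter_filter)
    also have "\<dots> = t * u (vs ! i)"
      using eigen i assms(2) by (metis nth_mem)
    finally show "(adjacency_matrix vs G *\<^sub>v ?v) $ i = (t \<cdot>\<^sub>v ?v) $ i"
      using i by simp
  qed (simp add: adjacency_matrix_def)
qed

section \<open>Counting the zeros\<close>

lemma boole_uminus: "boole (- x) = - boole x"
  by (simp add: boole_def)

lemma boole_strict_mono: "0 < x \<Longrightarrow> x < y \<Longrightarrow> boole x < boole y"
  unfolding boole_def using less_imp_inverse_less[of x y] by linarith

lemma boole_le_iff: 
  assumes "0 < x * y" 
  shows "boole x \<le> boole y \<longleftrightarrow> x \<le> y"
proof (cases "x < 0")
  case True
  with assms have "y < 0" by (simp add: zero_less_mult_iff)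
  then show ?thesis
    using True boole_strict_mono[of "-x" "-y"] boole_strict_mono[of "-y" "-x"]
    by (cases x y rule: linorder_cases) (auto simp: boole_uminus)
next
  case False
  with assms have "x > 0" "y > 0" by (auto simp: zero_less_mult_iff)
  then show ?thesis
    using boole_strict_mono[of x y] boole_strict_mono[of y x]
    by (cases x y rule: linorder_cases) auto
qed

lemma boole_surj_pos: "\<exists>x>0. boole x = z"
proof (intro exI conjI)
  \<comment> \<open>The positive root of \<open>x\<^sup>2 - z x - 1\<close>, which is the equation \<open>T x = z\<close> cleared of fractions.\<close>
  let ?x = "(z + sqrt (z\<^sup>2 + 4)) / 2"
  have "- z < sqrt (z\<^sup>2 + 4)"
    by (rule real_less_rsqrt) simp
  then show pos: "?x > 0" by simp
  have "?x * ?x = z * ?x + 1"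
    by (simp add: field_simps power2_eq_square flip: power2_eq_square[of "sqrt _"])
  moreover have "boole x * x = x * x - 1" if "x > 0" for x
    using that by (simp add: boole_def left_diff_distrib)
  ultimately have "boole ?x * ?x = z * ?x"
    using pos by (metis add_diff_cancel_right')
  then show "boole ?x = z" using pos by simp
qed

text \<open>Each branch of Boole's transformation is a bijection onto the line, so that counting preimages
  on one half-line amounts to counting on the whole line. The half-line is selected by the sign of
  \<open>\<sigma>\<close>, so that one statement serves for both branches.\<close>

lemma card_boole_vimage:
  fixes \<sigma> :: real
  assumes "\<sigma> \<noteq> 0"
  shows "card {x. 0 < \<sigma> * x \<and> boole x \<in> S} = card S"
proof -
  have surj: "\<exists>x. 0 < \<sigma> * x \<and> boole x = z" for z
  proof (cases "\<sigma> > 0")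
    case True
    then show ?thesis using boole_surj_pos[of z] mult_pos_pos[OF True] by blast
  next
    case False
    with assms obtain x where "x > 0" "boole x = - z" using boole_surj_pos by blast
    then show ?thesis using False assms
      by (intro exI[of _ "- x"]) (auto simp: boole_uminus mult_neg_pos)
  qed
  have "bij_betw boole {x. 0 < \<sigma> * x \<and> boole x \<in> S} S"
  proof (rule bij_betw_imageI)
    show "inj_on boole {x. 0 < \<sigma> * x \<and> boole x \<in> S}"
    proof (rule inj_onI)
      fix x y assume *: "x \<in> {x. 0 < \<sigma> * x \<and> boole x \<in> S}" "y \<in> {x. 0 < \<sigma> * x \<and> boole x \<in> S}"
        "boole x = boole y"
      then have "0 < x * y" "0 < y * x" by (auto simp: zero_less_mult_iff)
      from boole_le_iff[OF this(1)] boole_le_iff[OF this(2)] show "x = y"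
        unfolding *(3) by simp
    qed
    show "boole ` {x. 0 < \<sigma> * x \<and> boole x \<in> S} = S"
    proof (intro equalityI subsetI)
      fix z assume "z \<in> S"
      with surj[of z] show "z \<in> boole ` {x. 0 < \<sigma> * x \<and> boole x \<in> S}" by auto
    qed auto
  qed
  then show ?thesis by (rule bij_betw_same_card)
qed

lemma finite_card_boole_zeros: "finite (boole_zeros n) \<and> card (boole_zeros n) = 2 ^ n"
proof (induction n)
  case (Suc n)
  let ?P = "{x. 0 < 1 * x \<and> boole x \<in> boole_zeros n}"
  let ?N = "{x. 0 < -1 * x \<and> boole x \<in> boole_zeros n}"
  have card: "card ?P = 2 ^ n" "card ?N = 2 ^ n"
    using card_boole_vimage[of 1 "boole_zeros n"] card_boole_vimage[of "-1" "boole_zeros n"] Suc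
    by simp_all
  then have fin: "finite ?P" "finite ?N" by (auto intro: card_ge_0_finite)
  have "boole_zeros (Suc n) = ?P \<union> ?N" by auto
  then show ?case using fin card by (auto simp: card_Un_disjoint disjoint_iff)
qed simp

lemmas finite_boole_zeros = finite_card_boole_zeros[THEN conjunct1]
  and card_boole_zeros = finite_card_boole_zeros[THEN conjunct2]

definition zeros_cdf :: "nat \<Rightarrow> real \<Rightarrow> real" where
  "zeros_cdf n x = card (boole_zeros n \<inter> {..x}) / 2 ^ n"

text \<open>Zeros of the new level up to a negative \<open>x\<close> correspond to zeros of the old level up to \<open>T x\<close>,
  because \<open>T\<close> increases on the negative half-line. For a positive \<open>x\<close> all \<open>2\<^sup>n\<close> negative zeros are
  counted in addition.\<close>

lemma zeros_cdf_Suc: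
  "zeros_cdf (Suc n) x =
    (if x < 0 then zeros_cdf n (boole x) / 2
     else if x = 0 then 1 / 2 else (1 + zeros_cdf n (boole x)) / 2)"
proof -
  have neg: "card (boole_zeros (Suc n) \<inter> {..x}) = card (boole_zeros n \<inter> {..boole x})" if "x < 0" for x
  proof -
    have "boole_zeros (Suc n) \<inter> {..x} = {y. 0 < x * y \<and> boole y \<in> boole_zeros n \<inter> {..boole x}}"
      using that boole_le_iff[of _ x]
      by (auto simp: mult_neg_neg mult.commute zero_less_mult_iff)
    then show ?thesis
      using card_boole_vimage[of x "boole_zeros n \<inter> {..boole x}"] that by simp
  qed
  have zero: "boole_zeros (Suc n) \<inter> {..0} = {y. 0 < -1 * y \<and> boole y \<in> boole_zeros n}"
    by auto
  have card0: "card (boole_zeros (Suc n) \<inter> {..0}) = 2 ^ n"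
    unfolding zero by (subst card_boole_vimage) (auto simp: card_boole_zeros)
  have pos: "card (boole_zeros (Suc n) \<inter> {..x}) = 2 ^ n + card (boole_zeros n \<inter> {..boole x})"
    if "x > 0" for x
  proof -
    have "boole_zeros (Suc n) \<inter> {..x} = boole_zeros (Suc n) \<inter> {..0} \<union>
        {y. 0 < x * y \<and> boole y \<in> boole_zeros n \<inter> {..boole x}}" (is "_ = ?A \<union> ?B")
      using that boole_le_iff[of _ x]
      by (auto simp: mult.commute zero_less_mult_iff)
    moreover have "card ?B = card (boole_zeros n \<inter> {..boole x})"
      using card_boole_vimage[of x "boole_zeros n \<inter> {..boole x}"] that by simp
    moreover have "?A \<inter> ?B = {}" using that by (auto simp: zero_less_mult_iff)
    moreover have "finite ?A" using finite_boole_zeros by blast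
    moreover have "finite ?B"
      by (rule finite_subset[OF _ finite_boole_zeros[of "Suc n"]]) auto
    ultimately show ?thesis using card0 by (simp add: card_Un_disjoint)
  qed
  show ?thesis
    using neg[of x] pos[of x] card0 by (auto simp: zeros_cdf_def field_simps)
qed

section \<open>The empirical eigenvalue distribution\<close>

text \<open>A polynomial has no more roots, with multiplicity, than its degree, so finding that many
  distinct roots determines the whole multiset.\<close>

lemma proots_eq_mset_set:
  fixes p :: "'a :: idom poly"
  assumes "p \<noteq> 0" "card S = degree p" "\<And>x. x \<in> S \<Longrightarrow> poly p x = 0"
  shows "proots p = mset_set S"
proof -
  have "finite S"
    by (rule finite_subset[OF _ poly_roots_finite[OF \<open>p \<noteq> 0\<close>]]) (use assms in auto)
  have "mset_set S \<subseteq># proots p"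
  proof (rule mset_subset_eqI)
    fix x show "count (mset_set S) x \<le> count (proots p) x"
      using assms \<open>finite S\<close> by (cases "x \<in> S") (auto simp: order_root Suc_le_eq)
  qed
  moreover have "size (proots p) \<le> size (mset_set S)"
    using size_proots_le[of p] assms by simp
  ultimately show ?thesis
    by (metis mset_subset_size subset_mset.le_less not_less)
qed

lemma pmf_of_multiset_mset_set:
  assumes "finite S" "S \<noteq> {}"
  shows "pmf_of_multiset (mset_set S) = pmf_of_set S"
  using map_pmf_of_set[OF assms, of id] by (simp add: pmf.map_id)

lemma empirical_eigenvalue_distribution_comb_power:
  fixes V :: "'a set"
  assumes V: "card V = 2" and r: "r \<in> V"
    and vs: "distinct vs" "set vs = rg_verts (comb_power (complete_rooted_graph V r) n)"
  shows "empirical_eigenvalue_distribution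
      (adjacency_matrix vs (comb_power (complete_rooted_graph V r) n)) =
    distr (pmf_of_set (boole_zeros n)) borel (\<lambda>x. x)"
proof -
  let ?G = "comb_power (complete_rooted_graph V r) n"
  let ?A = "adjacency_matrix vs ?G"
  have "length vs = 2 ^ n"
    using vs V card_verts_comb_power[of "complete_rooted_graph V r" n]
    by (metis card.infinite complete_rooted_graph_simps(1) distinct_card zero_neq_numeral)
  then have A: "?A \<in> carrier_mat (2 ^ n) (2 ^ n)" by (simp add: adjacency_matrix_def)
  have "poly (char_poly ?A) t = 0" if "t \<in> boole_zeros n" for t
  proof -
    have "eigenvector ?A (vec (length vs) (\<lambda>i. root_response r t (vs ! i))) t"
      using that adjacency_root_response[OF V r, of _ n t]
        root_in_verts_comb_power[of "complete_rooted_graph V r" n] r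
      by (intro eigenvector_of_adjacency_sum[where z = "replicate n r"] vs)
         (auto simp: boole_zeros_iff)
    then show ?thesis
      using eigenvalue_root_char_poly[OF A] by (auto simp: eigenvalue_def)
  qed
  moreover have "degree (char_poly ?A) = 2 ^ n" "char_poly ?A \<noteq> 0"
    using degree_monic_char_poly[OF A] by auto
  ultimately have "proots (char_poly ?A) = mset_set (boole_zeros n)"
    by (intro proots_eq_mset_set) (auto simp: card_boole_zeros)
  moreover have "boole_zeros n \<noteq> {}"
    using card_boole_zeros[of n] by auto
  ultimately show ?thesis
    by (simp add: empirical_eigenvalue_distribution_def pmf_of_multiset_mset_set finite_boole_zeros)
qed

lemma cdf_uniform_boole_zeros:
  "cdf (distr (pmf_of_set (boole_zeros n)) borel (\<lambda>x. x)) = zeros_cdf n"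
proof
  fix x
  have "boole_zeros n \<noteq> {}"
    using card_boole_zeros[of n] by auto
  then show "cdf (distr (pmf_of_set (boole_zeros n)) borel (\<lambda>x. x)) x = zeros_cdf n x"
    by (simp add: cdf_def measure_distr measure_pmf_of_set finite_boole_zeros card_boole_zeros
        zeros_cdf_def)
qed

section \<open>Smyth's function\<close>

definition symmetric_cdf :: "(real \<Rightarrow> real) \<Rightarrow> real \<Rightarrow> real" where
  "symmetric_cdf L x = (if x < 0 then (1 - L (- x)) / 2 else (1 + L x) / 2)"

context
  fixes L :: "real \<Rightarrow> real"
  assumes L: "smyth_function L"
begin

lemma smyth_0: "L 0 = 0"
  and smyth_nonneg: "x \<ge> 0 \<Longrightarrow> 0 \<le> L x"
  and smyth_less_1: "x \<ge> 0 \<Longrightarrow> L x < 1"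
  and smyth_mono: "0 \<le> x \<Longrightarrow> x \<le> y \<Longrightarrow> L x \<le> L y"
  and smyth_boole: "x > 0 \<Longrightarrow> \<bar>2 * L x - 1\<bar> = L \<bar>boole x\<bar>"
  using L by (auto simp: smyth_function_def boole_def strict_mono_on_def le_less)

text \<open>The equation at \<open>x = 1\<close> forces the value \<open>1 / 2\<close> there. By monotonicity \<open>2 L x - 1\<close> and \<open>T x\<close>
  therefore both change sign at \<open>1\<close>, and the two absolute values in Smyth's equation can be resolved
  simultaneously.\<close>

lemma symmetric_cdf_boole_pos:
  assumes "x > 0"
  shows "symmetric_cdf L (boole x) = L x"
proof -
  have 1: "L 1 = 1 / 2" using smyth_boole[of 1] smyth_0 by (simp add: boole_def)
  show ?thesis
  proof (cases "x < 1")
    case True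
    then have "boole x < 0" using boole_strict_mono[of x 1] assms by (simp add: boole_def)
    moreover have "L x \<le> 1 / 2" using smyth_mono[of x 1] 1 True assms by simp
    ultimately show ?thesis using smyth_boole[OF assms] by (simp add: symmetric_cdf_def)
  next
    case False
    then have "boole x \<ge> 0" using boole_le_iff[of 1 x] by (simp add: boole_def)
    moreover have "L x \<ge> 1 / 2" using smyth_mono[of 1 x] 1 False by simp
    ultimately show ?thesis using smyth_boole[OF assms] by (simp add: symmetric_cdf_def)
  qed
qed

lemma symmetric_cdf_uminus: "symmetric_cdf L (- x) = 1 - symmetric_cdf L x"
  by (auto simp: symmetric_cdf_def smyth_0 field_simps)

lemma symmetric_cdf_boole:
  "symmetric_cdf L x =
    (if x < 0 then symmetric_cdf L (boole x) / 2
     else if x = 0 then 1 / 2 else (1 + symmetric_cdf L (boole x)) / 2)"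
proof -
  have "symmetric_cdf L (boole x) = 1 - L (- x)" if "x < 0"
    using symmetric_cdf_boole_pos[of "- x"] that symmetric_cdf_uminus[of "boole x"]
    by (simp add: boole_uminus)
  then show ?thesis
    using symmetric_cdf_boole_pos[of x] by (auto simp: symmetric_cdf_def smyth_0)
qed

lemma symmetric_cdf_bounds: "0 \<le> symmetric_cdf L x" "symmetric_cdf L x \<le> 1"
  using smyth_nonneg[of x] smyth_nonneg[of "-x"] smyth_less_1[of x] smyth_less_1[of "-x"]
  by (auto simp: symmetric_cdf_def)

text \<open>Both functions satisfy the same recursion, in which the value at \<open>T x\<close> enters with the factor
  \<open>1 / 2\<close>; at level \<open>0\<close> they differ by at most \<open>1\<close> because both take values in the unit interval.\<close>

lemma zeros_cdf_near_symmetric_cdf: "\<bar>zeros_cdf n x - symmetric_cdf L x\<bar> \<le> (1 / 2) ^ n"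
proof (induction n arbitrary: x)
  case 0
  have "card ({0} \<inter> {..x}) \<le> 1" using card_mono[of "{0}" "{0} \<inter> {..x}"] by simp
  then show ?case
    using symmetric_cdf_bounds[of x] by (simp add: zeros_cdf_def abs_le_iff)
next
  case (Suc n)
  let ?d = "zeros_cdf n (boole x) - symmetric_cdf L (boole x)"
  have "zeros_cdf (Suc n) x - symmetric_cdf L x = (if x = 0 then 0 else ?d / 2)"
    by (subst zeros_cdf_Suc, subst symmetric_cdf_boole) (simp add: field_simps)
  also have "\<bar>\<dots>\<bar> \<le> (1 / 2) ^ Suc n"
    using Suc.IH[of "boole x"] by simp
  finally show ?case .
qed

lemma zeros_cdf_uniform_limit: "uniform_limit UNIV zeros_cdf (symmetric_cdf L) sequentially"
proof (rule uniform_limitI)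
  fix e :: real assume "e > 0"
  have "(\<lambda>n. (1 / 2 :: real) ^ n) \<longlonglongrightarrow> 0" by (rule LIMSEQ_realpow_zero) auto
  then have "\<forall>\<^sub>F n in sequentially. (1 / 2) ^ n < e"
    using \<open>e > 0\<close> by (rule order_tendstoD(2))
  then show "\<forall>\<^sub>F n in sequentially. \<forall>x\<in>UNIV. dist (zeros_cdf n x) (symmetric_cdf L x) < e"
    by eventually_elim
       (auto simp: dist_real_def intro: le_less_trans[OF zeros_cdf_near_symmetric_cdf])
qed

lemma zeros_cdf_tendsto: "(\<lambda>n. zeros_cdf n x) \<longlonglongrightarrow> symmetric_cdf L x"
  by (rule tendsto_uniform_limitI[OF zeros_cdf_uniform_limit]) simp

lemma real_distribution_uniform_boole_zeros:
  "real_distribution (distr (pmf_of_set (boole_zeros n)) borel (\<lambda>x. x))"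
  by (rule prob_space.real_distribution_distr) (auto intro: prob_space_measure_pmf)

text \<open>Distribution functions are right-continuous, and this passes to their uniform limit. The
  reflection \<open>F (- x) = 1 - F x\<close> exchanges the two sides.\<close>

lemma isCont_symmetric_cdf: "isCont (symmetric_cdf L) x"
proof -
  have right: "(symmetric_cdf L \<longlongrightarrow> symmetric_cdf L a) (at_right a)" for a
  proof (rule swap_uniform_limit')
    show "\<forall>\<^sub>F n in sequentially. (zeros_cdf n \<longlongrightarrow> zeros_cdf n a) (at_right a)"
      using finite_borel_measure.cdf_is_right_cont[OF
          real_distribution.finite_borel_measure_M[OF real_distribution_uniform_boole_zeros]]
      by (simp add: cdf_uniform_boole_zeros continuous_within)
  qed (use zeros_cdf_tendsto zeros_cdf_uniform_limit in auto)
  have "((\<lambda>y. 1 - symmetric_cdf L (- y)) \<longlongrightarrow> 1 - symmetric_cdf L (- x)) (at_left x)"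
    unfolding at_left_minus[of x] filterlim_filtermap
    by (intro tendsto_intros) (simp add: right)
  then have "(symmetric_cdf L \<longlongrightarrow> symmetric_cdf L x) (at_left x)"
    by (simp add: symmetric_cdf_uminus)
  with right show ?thesis
    by (simp add: isCont_def filterlim_at_split)
qed

lemma symmetric_cdf_at_top: "(symmetric_cdf L \<longlongrightarrow> 1) at_top"
proof (rule swap_uniform_limit')
  show "\<forall>\<^sub>F n in sequentially. (zeros_cdf n \<longlongrightarrow> 1) at_top"
    using real_distribution.cdf_lim_at_top_prob[OF real_distribution_uniform_boole_zeros]
    by (simp add: cdf_uniform_boole_zeros)
qed (use zeros_cdf_uniform_limit in auto)

lemma
  shows real_distribution_half_line_measure: "real_distribution (half_line_measure L)"
    and cdf_half_line_measure: "cdf (half_line_measure L) = (\<lambda>x. if x < 0 then 0 else L x)"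
    and isCont_cdf_half_line_measure: "isCont (cdf (half_line_measure L)) x"
proof -
  let ?G = "\<lambda>x. if x < 0 then 0 else L x"
  \<comment> \<open>This form makes continuity at the junction \<open>0\<close> visible.\<close>
  have G: "?G = (\<lambda>x. max 0 (2 * symmetric_cdf L x - 1))"
  proof
    fix x
    show "?G x = max 0 (2 * symmetric_cdf L x - 1)"
      using smyth_nonneg[of x] smyth_nonneg[of "- x"]
      by (cases "x < 0") (auto simp: symmetric_cdf_def diff_divide_distrib add_divide_distrib)
  qed
  have cont: "isCont ?G x" for x
    unfolding G by (intro continuous_intros isCont_symmetric_cdf)
  then have rcont: "continuous (at_right x) ?G" for x
    using continuous_at_imp_continuous_at_within by blast
  have mono: "?G x \<le> ?G y" if "x \<le> y" for x y
    using smyth_mono[of x y] smyth_nonneg[of y] that by auto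
  have top: "(?G \<longlongrightarrow> 1) at_top"
  proof -
    have "((\<lambda>x. max 0 (2 * symmetric_cdf L x - 1)) \<longlongrightarrow> max 0 (2 * 1 - 1)) at_top"
      by (intro tendsto_intros symmetric_cdf_at_top)
    then show ?thesis unfolding G by simp
  qed
  have bot: "(?G \<longlongrightarrow> 0) at_bot"
    by (rule tendsto_eventually, rule eventually_mono[OF eventually_gt_at_bot[of 0]]) simp
  show "real_distribution (half_line_measure L)"
    unfolding half_line_measure_def by (rule real_distribution_interval_measure[OF mono rcont bot top])
  show cdf: "cdf (half_line_measure L) = ?G"
    unfolding half_line_measure_def by (rule cdf_interval_measure[OF mono rcont bot])
  show "isCont (cdf (half_line_measure L)) x"
    unfolding cdf by (rule cont)
qed

end

text \<open>The reflection turns closed lower rays into closed upper rays, whose measure is \<open>1\<close> minus a left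
  limit of the distribution function. As continuity excludes atoms, this left limit is the value.\<close>

lemma cdf_symmetrization:
  assumes M: "real_distribution M" and cont: "\<And>x. isCont (cdf M) x" and 0: "cdf M 0 = 0"
  shows "cdf (symmetrization M) = symmetric_cdf (cdf M)"
proof
  fix x :: real
  interpret real_distribution M by fact
  have open_ray: "measure M {..<a} = cdf M a" for a
  proof -
    have "measure M {..a} = measure M {..<a} + measure M {a}"
      by (subst finite_measure_Union[symmetric]) (auto intro: arg_cong[of _ _ "measure M"])
    then show ?thesis using cont[of a, unfolded isCont_cdf] by (simp add: cdf_def)
  qed
  have upper: "measure M {a..} = 1 - cdf M a" for a
    using prob_compl[of "{..<a}"] open_ray[of a] by (simp add: Compl_eq_Diff_UNIV[symmetric])
  have between: "measure M {0..a} = cdf M a" if "a \<ge> 0" for a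
  proof -
    have "measure M {..a} = measure M {..<0} + measure M {0..a}"
      by (subst finite_measure_Union[symmetric])
         (use that in \<open>auto intro: arg_cong[of _ _ "measure M"]\<close>)
    then show ?thesis using open_ray[of 0] 0 by (simp add: cdf_def)
  qed
  have refl: "uminus ` {..x} = {- x..}" by simp
  have "emeasure (symmetrization M) {..x} =
      (emeasure M ({..x} \<inter> {0..}) + emeasure M ({- x..} \<inter> {0..})) / 2"
    using emeasure_symmetrization[of M "{..x}"] by (simp add: refl)
  also have "\<dots> = ennreal ((measure M ({..x} \<inter> {0..}) + measure M ({- x..} \<inter> {0..})) / 2)"
    by (simp add: emeasure_eq_measure divide_ennreal[symmetric] ennreal_plus)
  finally have "cdf (symmetrization M) x =
      (measure M ({..x} \<inter> {0..}) + measure M ({- x..} \<inter> {0..})) / 2"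
    by (simp add: cdf_def measure_def)
  also have "\<dots> = symmetric_cdf (cdf M) x"
  proof (cases "x < 0")
    case True
    then have "{..x} \<inter> {0..} = {}" "{- x..} \<inter> {0..} = {- x..}" by auto
    then show ?thesis using True upper by (simp add: symmetric_cdf_def)
  next
    case False
    then have "{..x} \<inter> {0..} = {0..x}" "{- x..} \<inter> {0..} = {0..}" by auto
    then show ?thesis using False upper[of 0] between[of x] 0 by (simp add: symmetric_cdf_def)
  qed
  finally show "cdf (symmetrization M) x = symmetric_cdf (cdf M) x" .
qed

theorem theorem7p12:
  fixes V :: "'a set" and r :: 'a
    and vs :: "nat \<Rightarrow> 'a list list"
    and L :: "real \<Rightarrow> real"
  assumes "card V = 2" and "r \<in> V"
    and "\<And>N. distinct (vs N)"
    and "\<And>N. set (vs N) = rg_verts (comb_power (complete_rooted_graph V r) N)"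
    and "smyth_function L"
  shows "weak_conv_m
    (\<lambda>N. empirical_eigenvalue_distribution
           (adjacency_matrix (vs N) (comb_power (complete_rooted_graph V r) N)))
    (symmetrization (half_line_measure L))"
proof -
  note L = \<open>smyth_function L\<close>
  have "cdf (symmetrization (half_line_measure L)) = symmetric_cdf (cdf (half_line_measure L))"
    by (rule cdf_symmetrization[OF real_distribution_half_line_measure[OF L]
          isCont_cdf_half_line_measure[OF L]])
       (simp add: cdf_half_line_measure[OF L] smyth_0[OF L])
  also have "\<dots> = symmetric_cdf L"
    by (auto simp: symmetric_cdf_def cdf_half_line_measure[OF L])
  finally show ?thesis
    using zeros_cdf_tendsto[OF L]
    by (simp add: weak_conv_m_def weak_conv_def cdf_uniform_boole_zeros
        empirical_eigenvalue_distribution_comb_power assms)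
qed

end
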